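(* Let $n\ge 2$, let $\mathcal{L}$ be an $n$-Lie algebra, let $(V,\mu)$ be a representation of $\mathcal{L}$, and let $f\in C^2(\mathcal{L},V)=\mathrm{Hom}(\wedge^n\mathcal{L},V)$. Then the space $V\,{}_f\!\rtimes\mathcal{L}:=V\oplus\mathcal{L}$ is an $n$-Lie algebra through $$[v_1+x_1,\ldots,v_n+x_n]:=\sum_{k=1}^{n}(-1)^{k+1}\mu(x_1,\ldots,\widehat{x_k},\ldots,x_n)(v_k)+(-1)^{n+1}f(x_1,\ldots,x_n)+(-1)^{n+1}[x_1,\ldots,x_n]$$ (for $v_k\in V$, $x_k\in\mathcal{L}$) if and only if $f\in Z^2(\mathcal{L},V)$.
   Context: All vector spaces are over a fixed ground field $k$; $\widehat{\phantom{x}}$ denotes omission. An $n$-Lie algebra is a vector space $\mathcal{L}$ with a linear map $[\,,\ldots,\,]:\wedge^n\mathcal{L}\to\mathcal{L}$ satisfying the fundamental identity $$[x_1,\ldots,x_{n-1},[x_n,\ldots,x_{2n-1}]]=\sum_{k=0}^{n-1}[x_n,\ldots,[x_1,\ldots,x_{n-1},x_{n+k}],\ldots,x_{2n-1}]$$ for all $x_1,\ldots,x_{2n-1}\in\mathcal{L}$ (the inner bracket replaces $x_{n+k}$ in its slot). A representation of $\mathcal{L}$ is a vector space $V$ with a linear map $\mu:\wedge^{n-1}\mathcal{L}\to g\ell(V)$ (linear endomorphisms of $V$) such that, for all $x_1,\ldots,x_{2n-2}\in\mathcal{L}$, $$\mu(x_1,\ldots,x_{n-1})\mu(x_n,\ldots,x_{2n-2})-\mu(x_n,\ldots,x_{2n-2})\mu(x_1,\ldots,x_{n-1})=\sum_{k=0}^{n-2}\mu(x_n,\ldots,[x_1,\ldots,x_{n-1},x_{n+k}],\ldots,x_{2n-2}),$$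 $$\mu([x_1,\ldots,x_n],x_{n+1},\ldots,x_{2n-2})=\sum_{k=1}^n(-1)^k\mu(x_1,\ldots,\widehat{x_k},\ldots,x_n)\mu(x_{n+1},\ldots,x_{2n-2},x_k).$$ For $f\in C^2(\mathcal{L},V)=\mathrm{Hom}(\wedge^n\mathcal{L},V)$, $x_i=x_i^1\wedge\cdots\wedge x_i^{n-1}\in\wedge^{n-1}\mathcal{L}$ ($i=1,2$) and $y\in\mathcal{L}$, write $f(x_i,y)=f(x_i^1,\ldots,x_i^{n-1},y)$, $[x_i,y]=[x_i^1,\ldots,x_i^{n-1},y]$, $\mu(x_i)=\mu(x_i^1,\ldots,x_i^{n-1})$, and $[x_1,x_2]=\sum_{k=1}^{n-1}x_2^1\wedge\cdots\wedge[x_1^1,\ldots,x_1^{n-1},x_2^k]\wedge\cdots\wedge x_2^{n-1}$. The differential is $$\delta f(x_1,x_2,y)=-f([x_1,x_2],y)-f(x_2,[x_1,y])+f(x_1,[x_2,y])+\mu(x_1)(f(x_2,y))-\mu(x_2)(f(x_1,y))+\sum_{i=1}^{n-1}(-1)^{n+1+i}\mu(x_2^1,\ldots,\widehat{x_2^i},\ldots,x_2^{n-1},y)\big(f(x_1,x_2^i)\big),$$ and $Z^2(\mathcal{L},V)=\{f\in C^2(\mathcal{L},V)\mid \delta f=0\}$. *)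

theory Defs
  imports "HOL-Analysis.Product_Vector"
begin

text \<open>
  An \<open>m\<close>-ary map is a function on lists, of which only the values on lists of length \<open>m\<close> matter.
  List positions are counted from 0, so that slot \<open>k\<close> here is slot \<open>k + 1\<close> in the usual notation;
  this is why the signs below contain \<open>Suc k\<close>.
\<close>

text \<open>
  A linear map \<open>\<And>\<^sup>m W \<rightarrow> U\<close> is identified with an alternating \<open>m\<close>-linear map (universal
  property of the exterior power). Alternating means vanishing on arguments with a repetition,
  which is the correct notion in every characteristic.
\<close>

definition multilinear_map ::
  "nat \<Rightarrow> ('k::field \<Rightarrow> 'w::ab_group_add \<Rightarrow> 'w) \<Rightarrow> ('k \<Rightarrow> 'u::ab_group_add \<Rightarrow> 'u)
    \<Rightarrow> ('w list \<Rightarrow> 'u) \<Rightarrow> bool" where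
  "multilinear_map m sW sU g \<longleftrightarrow>
     (\<forall>ws k. length ws = m \<and> k < m \<longrightarrow> Vector_Spaces.linear sW sU (\<lambda>w. g (ws[k := w])))"

definition alternating_map ::
  "nat \<Rightarrow> ('k::field \<Rightarrow> 'w::ab_group_add \<Rightarrow> 'w) \<Rightarrow> ('k \<Rightarrow> 'u::ab_group_add \<Rightarrow> 'u)
    \<Rightarrow> ('w list \<Rightarrow> 'u) \<Rightarrow> bool" where
  "alternating_map m sW sU g \<longleftrightarrow>
     multilinear_map m sW sU g \<and> (\<forall>ws. length ws = m \<and> \<not> distinct ws \<longrightarrow> g ws = 0)"

definition omit_nth :: "nat \<Rightarrow> 'a list \<Rightarrow> 'a list" where
  "omit_nth k xs = take k xs @ drop (Suc k) xs"

locale n_Lie_algebra = vector_space sL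
  for n :: nat
    and sL :: "'k::field \<Rightarrow> 'l::ab_group_add \<Rightarrow> 'l"
    and br :: "'l list \<Rightarrow> 'l" +
  assumes bracket_alternating: "alternating_map n sL sL br"
    and fundamental_identity:
      "\<And>xs ys. length xs = n - 1 \<Longrightarrow> length ys = n \<Longrightarrow>
         br (xs @ [br ys]) = (\<Sum>k<n. br (ys[k := br (xs @ [ys ! k])]))"

text \<open>
  A linear map \<open>\<And>\<^sup>n\<^sup>-\<^sup>1 L \<rightarrow> gl(V)\<close> is a family of endomorphisms of \<open>V\<close> that is pointwise, for each
  \<open>v\<close>, alternating and multilinear, since the operations of \<open>gl(V)\<close> are pointwise.
\<close>

locale n_Lie_representation = n_Lie_algebra n sL br + V: vector_space sV
  for n :: nat
    and sL :: "'k::field \<Rightarrow> 'l::ab_group_add \<Rightarrow> 'l"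
    and br :: "'l list \<Rightarrow> 'l"
    and sV :: "'k \<Rightarrow> 'v::ab_group_add \<Rightarrow> 'v"
    and mu :: "'l list \<Rightarrow> 'v \<Rightarrow> 'v" +
  assumes mu_endomorphism:
      "\<And>xs. length xs = n - 1 \<Longrightarrow> Vector_Spaces.linear sV sV (mu xs)"
    and mu_alternating: "\<And>v. alternating_map (n - 1) sL sV (\<lambda>xs. mu xs v)"
    and mu_commutator:
      "\<And>xs ys v. length xs = n - 1 \<Longrightarrow> length ys = n - 1 \<Longrightarrow>
         mu xs (mu ys v) - mu ys (mu xs v) =
         (\<Sum>k<n - 1. mu (ys[k := br (xs @ [ys ! k])]) v)"
    and mu_bracket:
      "\<And>xs ys v. length xs = n \<Longrightarrow> length ys = n - 2 \<Longrightarrow>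
         mu (br xs # ys) v =
         (\<Sum>k<n. sV ((-1) ^ Suc k) (mu (omit_nth k xs) (mu (ys @ [xs ! k]) v)))"

definition C2 ::
  "nat \<Rightarrow> ('k::field \<Rightarrow> 'l::ab_group_add \<Rightarrow> 'l) \<Rightarrow> ('k \<Rightarrow> 'v::ab_group_add \<Rightarrow> 'v)
    \<Rightarrow> ('l list \<Rightarrow> 'v) set" where
  "C2 n sL sV = {f. alternating_map n sL sV f}"

text \<open>
  The arguments \<open>xs\<close> and \<open>ys\<close> of length \<open>n - 1\<close> stand for decomposable elements of \<open>\<And>\<^sup>n\<^sup>-\<^sup>1 L\<close>. The first
  sum is \<open>f([xs, ys], z)\<close>.
\<close>

definition coboundary ::
  "nat \<Rightarrow> ('l::ab_group_add list \<Rightarrow> 'l) \<Rightarrow> ('k::field \<Rightarrow> 'v::ab_group_add \<Rightarrow> 'v)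
    \<Rightarrow> ('l list \<Rightarrow> 'v \<Rightarrow> 'v) \<Rightarrow> ('l list \<Rightarrow> 'v) \<Rightarrow> 'l list \<Rightarrow> 'l list \<Rightarrow> 'l \<Rightarrow> 'v" where
  "coboundary n br sV mu f xs ys z =
     - (\<Sum>k<n - 1. f (ys[k := br (xs @ [ys ! k])] @ [z]))
     - f (ys @ [br (xs @ [z])])
     + f (xs @ [br (ys @ [z])])
     + mu xs (f (ys @ [z]))
     - mu ys (f (xs @ [z]))
     + (\<Sum>i<n - 1. sV ((-1) ^ (n + 1 + Suc i)) (mu (omit_nth i ys @ [z]) (f (xs @ [ys ! i]))))"

definition Z2 ::
  "nat \<Rightarrow> ('k::field \<Rightarrow> 'l::ab_group_add \<Rightarrow> 'l) \<Rightarrow> ('l list \<Rightarrow> 'l)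
    \<Rightarrow> ('k \<Rightarrow> 'v::ab_group_add \<Rightarrow> 'v) \<Rightarrow> ('l list \<Rightarrow> 'v \<Rightarrow> 'v) \<Rightarrow> ('l list \<Rightarrow> 'v) set" where
  "Z2 n sL br sV mu =
     {f \<in> C2 n sL sV. \<forall>xs ys z. length xs = n - 1 \<and> length ys = n - 1 \<longrightarrow>
        coboundary n br sV mu f xs ys z = 0}"

text \<open>The pair \<open>(v, x)\<close> is the element \<open>v + x\<close> of \<open>V \<oplus> L\<close>.\<close>

definition semidirect_bracket ::
  "nat \<Rightarrow> ('k::field \<Rightarrow> 'l::ab_group_add \<Rightarrow> 'l) \<Rightarrow> ('l list \<Rightarrow> 'l)
    \<Rightarrow> ('k \<Rightarrow> 'v::ab_group_add \<Rightarrow> 'v) \<Rightarrow> ('l list \<Rightarrow> 'v \<Rightarrow> 'v) \<Rightarrow> ('l list \<Rightarrow> 'v)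
    \<Rightarrow> ('v \<times> 'l) list \<Rightarrow> 'v \<times> 'l" where
  "semidirect_bracket n sL br sV mu f ps =
     (let vs = map fst ps; xs = map snd ps in
       ((\<Sum>k<n. sV ((-1) ^ (Suc k + 1)) (mu (omit_nth k xs) (vs ! k))) + sV ((-1) ^ (n + 1)) (f xs),
        sL ((-1) ^ (n + 1)) (br xs)))"

end

theory Submission
  imports Defs
begin

text \<open>
  Put \<open>\<epsilon> = (-1)\<^sup>n\<^sup>+\<^sup>1\<close> and let \<open>A\<close> be the part of the bracket on \<open>V \<oplus> L\<close> that comes from \<open>\<mu>\<close>, so
  that \<open>[p\<^sub>1, \<dots>, p\<^sub>n] = A(p\<^sub>1, \<dots>, p\<^sub>n) + \<epsilon> f(x\<^sub>1, \<dots>, x\<^sub>n) + \<epsilon> [x\<^sub>1, \<dots>, x\<^sub>n]\<close> with \<open>x\<^sub>i\<close> the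
  \<open>L\<close>-component of \<open>p\<^sub>i\<close>. This bracket is alternating for every alternating \<open>f\<close>: \<open>f\<close> and the bracket
  of \<open>L\<close> are pulled back along the projection to \<open>L\<close>, and when two arguments of \<open>A\<close> agree, the two
  summands that omit one of them differ by a cyclic rearrangement and cancel
  (\<open>action_alternating\<close>). Hence only the fundamental identity is at stake.

  The point is that the difference of its two sides is exactly \<open>\<delta>f\<close>
  (\<open>fundamental_identity_defect\<close>). The \<open>L\<close>-component of the difference is zero by the fundamental
  identity of \<open>L\<close>. In the \<open>V\<close>-component, the terms without \<open>f\<close> cancel because of the two axioms of a
  representation. The vector parts of the last \<open>n\<close> arguments are dealt with by the commutator
  axiom, which says that \<open>\<mu>(x\<^sub>1, \<dots>, x\<^sub>n\<^sub>-\<^sub>1)\<close> is a derivation of \<open>A\<close> (\<open>mu_derivation_action\<close>); those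
  of the first \<open>n - 1\<close> arguments by the axiom on \<open>\<mu>([x\<^sub>1, \<dots>, x\<^sub>n], \<dots>)\<close>
  (\<open>action_snoc_bracket\<close>). What remains is linear in \<open>f\<close>, depends on the \<open>L\<close>-components alone, and
  is the defining formula of \<open>\<delta>f\<close>. So the fundamental identity holds for all arguments if and only
  if \<open>\<delta>f = 0\<close>; one direction of the equivalence tests it on arguments with zero vector part.
\<close>

section \<open>Multilinear and alternating maps on lists\<close>

lemma multilinear_map_add:
  assumes "multilinear_map m sW sU g" "length ws = m" "k < m"
  shows "g (ws[k := a + b]) = g (ws[k := a]) + g (ws[k := b])"
  using assms unfolding multilinear_map_def Vector_Spaces.linear_iff by blast

lemma multilinear_map_scale:
  assumes "multilinear_map m sW sU g" "length ws = m" "k < m"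
  shows "g (ws[k := sW c a]) = sU c (g (ws[k := a]))"
  using assms unfolding multilinear_map_def Vector_Spaces.linear_iff by blast

lemma multilinear_map_zero:
  assumes "multilinear_map m sW sU g" "length ws = m" "k < m"
  shows "g (ws[k := 0]) = 0"
  using multilinear_map_add[OF assms, of 0 0] by simp

lemma alternating_map_multilinear: "alternating_map m sW sU g \<Longrightarrow> multilinear_map m sW sU g"
  by (simp add: alternating_map_def)

lemma alternating_map_repeat:
  "alternating_map m sW sU g \<Longrightarrow> length ws = m \<Longrightarrow> \<not> distinct ws \<Longrightarrow> g ws = 0"
  by (simp add: alternating_map_def)

text \<open>
  The usual polarisation: expand the vanishing value at \<open>x + y\<close> in both of the two slots.
\<close>

lemma alternating_map_swap:
  assumes g: "alternating_map m sW sU g" and len: "length (as @ x # y # cs) = m"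
  shows "g (as @ x # y # cs) = - g (as @ y # x # cs)"
proof -
  note add = multilinear_map_add[OF alternating_map_multilinear[OF g]]
  define h where "h a b = g (as @ a # b # cs)" for a b
  have h1: "h (a + a') b = h a b + h a' b" for a a' b
    using add[of "as @ a # b # cs" "length as" a a'] len by (simp add: h_def)
  have h2: "h a (b + b') = h a b + h a b'" for a b b'
    using add[of "as @ a # b # cs" "Suc (length as)" b b'] len
    by (simp add: h_def list_update_append)
  have h0: "h a a = 0" for a
    unfolding h_def by (rule alternating_map_repeat[OF g]) (use len in auto)
  have "h (x + y) (x + y) = h x y + h y x"
    unfolding h1 h2 by (simp add: h0)
  then show ?thesis
    by (simp add: h0 h_def eq_neg_iff_add_eq_0)
qed

lemma alternating_map_move:
  assumes g: "alternating_map m sW sU g" and U: "vector_space sU"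
    and len: "length (as @ x # bs @ cs) = m"
  shows "g (as @ x # bs @ cs) = sU ((-1) ^ length bs) (g (as @ bs @ x # cs))"
  using len
proof (induction bs arbitrary: as)
  case Nil
  then show ?case using vector_space.vector_space_assms(4)[OF U] by simp
next
  case (Cons b bs)
  interpret U: vector_space sU by (rule U)
  have "g (as @ x # b # bs @ cs) = - g ((as @ [b]) @ x # bs @ cs)"
    using alternating_map_swap[OF g, of as x b "bs @ cs"] Cons.prems by simp
  also have "\<dots> = - sU ((-1) ^ length bs) (g ((as @ [b]) @ bs @ x # cs))"
    using Cons.IH[of "as @ [b]"] Cons.prems by simp
  finally show ?case by (simp add: U.scale_minus_left)
qed

lemma alternating_map_comp_map:
  fixes h :: "'x::ab_group_add \<Rightarrow> 'w::ab_group_add"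
  assumes g: "alternating_map m sW sU g" and h: "Vector_Spaces.linear sX sW h"
  shows "alternating_map m sX sU (\<lambda>xs. g (map h xs))"
  unfolding alternating_map_def multilinear_map_def
proof (intro conjI allI impI; elim conjE)
  fix ws :: "'x list" and k
  assume len: "length ws = m" and k: "k < m"
  have "Vector_Spaces.linear sW sU (\<lambda>w. g ((map h ws)[k := w]))"
    using g len k by (simp add: alternating_map_def multilinear_map_def)
  from Vector_Spaces.linear_compose[OF h this]
  show "Vector_Spaces.linear sX sU (\<lambda>w. g (map h (ws[k := w])))"
    by (simp add: comp_def map_update)
next
  fix ws :: "'x list"
  assume "length ws = m" and "\<not> distinct ws"
  then show "g (map h ws) = 0"
    using alternating_map_repeat[OF g, of "map h ws"] by (simp add: distinct_map)
qed

section \<open>Omitting a list entry\<close>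

lemma length_omit_nth: "k < length xs \<Longrightarrow> length (omit_nth k xs) = length xs - 1"
  by (simp add: omit_nth_def)

lemma omit_nth_snoc: "k < length xs \<Longrightarrow> omit_nth k (xs @ [z]) = omit_nth k xs @ [z]"
  by (simp add: omit_nth_def)

lemma omit_nth_snoc_last: "k = length xs \<Longrightarrow> omit_nth k (xs @ [z]) = xs"
  by (simp add: omit_nth_def)

lemma omit_nth_update_same: "omit_nth k (xs[k := x]) = omit_nth k xs"
  by (simp add: omit_nth_def)

text \<open>
  Entries beyond the omitted position \<open>j\<close> move down by one, so position \<open>k\<close> is found at \<open>k - 1\<close> when
  \<open>k > j\<close>.
\<close>

lemma omit_nth_update_other:
  assumes "k < length xs" "j < length xs" "k \<noteq> j"
  shows "omit_nth j (xs[k := x]) = (omit_nth j xs)[if k < j then k else k - 1 := x]"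
  using assms
  by (cases "k < j") (auto simp: omit_nth_def list_update_append take_update_swap drop_update_swap
      list_update_beyond)

lemma nth_omit_nth:
  assumes "k < length xs" "j < length xs" "k \<noteq> j"
  shows "omit_nth j xs ! (if k < j then k else k - 1) = xs ! k"
  using assms by (auto simp: omit_nth_def nth_append min_def)

section \<open>The part of the semidirect bracket given by the representation\<close>

context n_Lie_representation
begin

abbreviation "scale_VL \<equiv> module_prod.scale sV sL"

lemma module_prod_VL: "module_prod sV sL"
  unfolding module_prod_def module_pair_def
  using V.module_axioms module_axioms by blast

lemma scale_VL: "scale_VL c p = (sV c (fst p), sL c (snd p))"
  by (simp add: module_prod.scale_def[OF module_prod_VL])

lemma vector_space_VL: "vector_space scale_VL"
  using V.vector_space_axioms vector_space_axioms
  unfolding vector_space_def scale_VL by auto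

lemma linear_snd: "Vector_Spaces.linear scale_VL sL snd"
  unfolding Vector_Spaces.linear_iff
  by (simp add: vector_space_VL vector_space_axioms scale_VL)

lemma mu_add: "length xs = n - 1 \<Longrightarrow> mu xs (v + w) = mu xs v + mu xs w"
  and mu_scale: "length xs = n - 1 \<Longrightarrow> mu xs (sV c v) = sV c (mu xs v)"
  using mu_endomorphism[of xs] unfolding Vector_Spaces.linear_iff by auto

lemma mu_zero: "length xs = n - 1 \<Longrightarrow> mu xs 0 = 0"
  using mu_add[of xs 0 0] by simp

lemma mu_sum: "length xs = n - 1 \<Longrightarrow> mu xs (\<Sum>i\<in>A. g i) = (\<Sum>i\<in>A. mu xs (g i))"
  by (induction A rule: infinite_finite_induct) (auto simp: mu_zero mu_add)

lemmas mu_multilinear = alternating_map_multilinear[OF mu_alternating]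

text \<open>
  With counting from 0, the sign \<open>(-1)\<^sup>k\<^sup>+\<^sup>1\<close> of the usual notation becomes \<open>(-1) ^ k\<close>.
\<close>

definition action :: "('v \<times> 'l) list \<Rightarrow> 'v" where
  "action ps = (\<Sum>k<n. sV ((-1) ^ k) (mu (omit_nth k (map snd ps)) (fst (ps ! k))))"

lemma action_multilinear: "multilinear_map n scale_VL sV action"
  unfolding multilinear_map_def
proof (intro allI impI, elim conjE)
  fix ps :: "('v \<times> 'l) list" and k
  assume len: "length ps = n" and k: "k < n"
  define t where "t j p = mu (omit_nth j (map snd (ps[k := p]))) (fst (ps[k := p] ! j))" for j p
  have t_other: "t j p = mu ((omit_nth j (map snd ps))[if k < j then k else k - 1 := snd p]) (fst (ps ! j))"
    if "j < n" "j \<noteq> k" for j p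
    using that len k by (simp add: t_def map_update omit_nth_update_other)
  have t_same: "t k p = mu (omit_nth k (map snd ps)) (fst p)" for p
    using len k by (simp add: t_def map_update omit_nth_update_same)
  have t_add: "t j (p + q) = t j p + t j q" if "j < n" for j p q
  proof (cases "j = k")
    case True
    then show ?thesis using k len by (simp add: t_same mu_add length_omit_nth)
  next
    case False
    then show ?thesis using k len that
      by (simp add: t_other length_omit_nth multilinear_map_add[OF mu_multilinear])
  qed
  have t_scale: "t j (scale_VL c p) = sV c (t j p)" if "j < n" for j c p
  proof (cases "j = k")
    case True
    then show ?thesis using k len by (simp add: t_same mu_scale length_omit_nth scale_VL)
  next
    case False
    then show ?thesis using k len that
      by (simp add: t_other scale_VL length_omit_nth multilinear_map_scale[OF mu_multilinear])
  qed
  have *: "action (ps[k := p]) = (\<Sum>j<n. sV ((-1) ^ j) (t j p))" for p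
    by (simp add: action_def t_def)
  show "Vector_Spaces.linear scale_VL sV (\<lambda>w. action (ps[k := w]))"
    unfolding Vector_Spaces.linear_iff *
    by (auto simp: vector_space_VL V.vector_space_axioms t_add t_scale V.scale_right_distrib
        sum.distrib V.scale_sum_right mult.commute)
qed

text \<open>
  Let \<open>p\<close> occur at the positions \<open>i < j\<close>. A summand that omits another position still sees the
  \<open>L\<close>-component of \<open>p\<close> twice and vanishes. Omitting position \<open>i\<close> and omitting position \<open>j\<close> gives
  lists that differ by moving that component over \<open>j - i - 1\<close> entries, whereas the signs in front
  differ by \<open>(-1)\<^sup>j\<^sup>-\<^sup>i\<close>; so the two remaining summands cancel.
\<close>

lemma action_alternating: "alternating_map n scale_VL sV action"
  unfolding alternating_map_def
proof (intro conjI allI impI action_multilinear, elim conjE)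
  fix ps :: "('v \<times> 'l) list"
  assume len: "length ps = n" and "\<not> distinct ps"
  then obtain as p bs cs where ps: "ps = as @ [p] @ bs @ [p] @ cs"
    using not_distinct_decomp by blast
  let ?i = "length as" and ?j = "Suc (length as + length bs)"
  let ?A = "map snd as" and ?B = "map snd bs" and ?C = "map snd cs"
  define t where "t k = sV ((-1) ^ k) (mu (omit_nth k (map snd ps)) (fst (ps ! k)))" for k
  have "t k = 0" if k: "k < n" "k \<noteq> ?i" "k \<noteq> ?j" for k
  proof -
    let ?zs = "omit_nth k (map snd ps)"
    define i' where "i' = (if ?i < k then ?i else ?i - 1)"
    define j' where "j' = (if ?j < k then ?j else ?j - 1)"
    have "?zs ! i' = snd p" "?zs ! j' = snd p"
      using nth_omit_nth[of ?i "map snd ps" k] nth_omit_nth[of ?j "map snd ps" k] k len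
      by (simp_all add: ps nth_append i'_def j'_def)
    moreover have "i' \<noteq> j'" "i' < length ?zs" "j' < length ?zs"
      using k len by (auto simp: length_omit_nth ps i'_def j'_def)
    ultimately have "\<not> distinct ?zs"
      using nth_eq_iff_index_eq[of ?zs i' j'] by auto
    then show ?thesis
      using k len alternating_map_repeat[OF mu_alternating, of "omit_nth k (map snd ps)"]
      by (simp add: t_def length_omit_nth)
  qed
  then have "action ps = (\<Sum>k\<in>{?i, ?j}. t k)"
    unfolding action_def t_def[symmetric]
    using len by (intro sum.mono_neutral_right) (auto simp: ps)
  also have "\<dots> = t ?i + t ?j" by simp
  also have "t ?i = sV ((-1) ^ ?i) (mu (?A @ ?B @ snd p # ?C) (fst p))"
    by (simp add: t_def ps omit_nth_def)
  also have "t ?j = sV ((-1) ^ ?j) (mu (?A @ snd p # ?B @ ?C) (fst p))"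
    by (simp add: t_def ps omit_nth_def nth_append)
  also have "mu (?A @ snd p # ?B @ ?C) (fst p)
      = sV ((-1) ^ length bs) (mu (?A @ ?B @ snd p # ?C) (fst p))"
    using alternating_map_move[OF mu_alternating V.vector_space_axioms, of ?A "snd p" ?B ?C] len
    by (simp add: ps)
  finally show "action ps = 0"
    by (simp add: power_add flip: power_mult_distrib)
qed

text \<open>
  An argument in \<open>V\<close> leaves a single summand, since in all others \<open>\<mu>\<close> has the entry 0.
\<close>

lemma action_update_vector:
  assumes len: "length ps = n" and k: "k < n"
  shows "action (ps[k := (w, 0)]) = sV ((-1) ^ k) (mu (omit_nth k (map snd ps)) w)"
proof -
  have "action (ps[k := (w, 0)])
      = (\<Sum>j<n. if j = k then sV ((-1) ^ k) (mu (omit_nth k (map snd ps)) w) else 0)"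
    unfolding action_def
  proof (rule sum.cong[OF refl])
    fix j assume j: "j \<in> {..<n}"
    have "mu ((omit_nth j (map snd ps))[if k < j then k else k - 1 := 0]) (fst (ps ! j)) = 0"
      if "j \<noteq> k"
      by (rule multilinear_map_zero[OF mu_multilinear]) (use that j k len in \<open>auto simp: length_omit_nth\<close>)
    then show "sV ((-1) ^ j) (mu (omit_nth j (map snd (ps[k := (w, 0)]))) (fst (ps[k := (w, 0)] ! j)))
        = (if j = k then sV ((-1) ^ k) (mu (omit_nth k (map snd ps)) w) else 0)"
      using j k len by (auto simp: map_update omit_nth_update_same omit_nth_update_other)
  qed
  also have "\<dots> = sV ((-1) ^ k) (mu (omit_nth k (map snd ps)) w)"
    using k by simp
  finally show ?thesis .
qed

text \<open>
  The commutator axiom for the list \<open>ys\<close> without its entry \<open>j\<close>, with the sum indexed by the positions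
  of \<open>ys\<close> itself.
\<close>

lemma mu_derivation_omit_nth:
  assumes xs: "length xs = n - 1" and ys: "length ys = n" and j: "j < n"
  shows "mu xs (mu (omit_nth j ys) v) = mu (omit_nth j ys) (mu xs v)
    + (\<Sum>k\<in>{..<n} - {j}. mu (omit_nth j (ys[k := br (xs @ [ys ! k])])) v)"
proof -
  have "(\<Sum>k\<in>{..<n} - {j}. mu (omit_nth j (ys[k := br (xs @ [ys ! k])])) v)
      = (\<Sum>i<n - 1. mu ((omit_nth j ys)[i := br (xs @ [omit_nth j ys ! i])]) v)"
  proof (rule sum.reindex_bij_witness[where i = "\<lambda>i. if i < j then i else Suc i"
        and j = "\<lambda>k. if k < j then k else k - 1"], goal_cases)
    case (5 k)
    then have "k < length ys" "j < length ys" "k \<noteq> j" using j ys by auto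
    from omit_nth_update_other[OF this] nth_omit_nth[OF this] show ?case by presburger
  qed (use j in auto)
  then show ?thesis
    using mu_commutator[OF xs, of "omit_nth j ys" v] ys j by (simp add: length_omit_nth algebra_simps)
qed

text \<open>
  \<open>\<mu>(xs)\<close>, together with \<open>[xs, -]\<close> on \<open>L\<close>, acts on the action as a derivation. Fix the summand \<open>j\<close>
  of the action: replacing entry \<open>j\<close> produces the term in which the two endomorphisms have changed
  places, and replacing the other entries produces the sum in the commutator axiom.
\<close>

lemma mu_derivation_action:
  assumes xs: "length xs = n - 1" and ps: "length ps = n"
  shows "mu xs (action ps)
    = (\<Sum>k<n. action (ps[k := (mu xs (fst (ps ! k)), br (xs @ [snd (ps ! k)]))]))"
proof -
  let ?ys = "map snd ps"
  define q where "q k = (mu xs (fst (ps ! k)), br (xs @ [snd (ps ! k)]))" for k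
  define t where "t k j = mu (omit_nth j (map snd (ps[k := q k]))) (fst (ps[k := q k] ! j))" for k j
  have t: "(\<Sum>k<n. t k j) = mu xs (mu (omit_nth j ?ys) (fst (ps ! j)))" if j: "j < n" for j
  proof -
    have "(\<Sum>k<n. t k j) = t j j + (\<Sum>k\<in>{..<n} - {j}. t k j)"
      using j by (simp add: sum.remove)
    also have "t j j = mu (omit_nth j ?ys) (mu xs (fst (ps ! j)))"
      using j ps by (simp add: t_def q_def map_update omit_nth_update_same)
    also have "(\<Sum>k\<in>{..<n} - {j}. t k j)
        = (\<Sum>k\<in>{..<n} - {j}. mu (omit_nth j (?ys[k := br (xs @ [?ys ! k])])) (fst (ps ! j)))"
      using ps by (intro sum.cong) (auto simp: t_def q_def map_update)
    finally show ?thesis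
      using mu_derivation_omit_nth[OF xs, of ?ys j] ps j by simp
  qed
  have "(\<Sum>k<n. action (ps[k := q k])) = (\<Sum>j<n. \<Sum>k<n. sV ((-1) ^ j) (t k j))"
    unfolding action_def t_def by (rule sum.swap)
  also have "\<dots> = (\<Sum>j<n. sV ((-1) ^ j) (mu xs (mu (omit_nth j ?ys) (fst (ps ! j)))))"
    by (simp add: V.scale_sum_right[symmetric] t)
  also have "\<dots> = mu xs (action ps)"
    using xs by (simp add: action_def mu_sum mu_scale)
  finally show ?thesis by (simp add: q_def)
qed

end

section \<open>The defect of the fundamental identity\<close>

locale n_Lie_cochain = n_Lie_representation n sL br sV mu
  for n :: nat
    and sL :: "'k::field \<Rightarrow> 'l::ab_group_add \<Rightarrow> 'l"
    and br :: "'l list \<Rightarrow> 'l"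
    and sV :: "'k \<Rightarrow> 'v::ab_group_add \<Rightarrow> 'v"
    and mu :: "'l list \<Rightarrow> 'v \<Rightarrow> 'v" +
  fixes f :: "'l list \<Rightarrow> 'v"
  assumes n_ge_2: "n \<ge> 2"
    and f_alternating: "alternating_map n sL sV f"
begin

text \<open>This is the sign \<open>\<epsilon>\<close>.\<close>

definition sgn_n :: 'k where "sgn_n = (-1) ^ (n + 1)"

lemma sgn_n_square: "sgn_n * sgn_n = 1"
  by (simp add: sgn_n_def flip: power_mult_distrib)

text \<open>Thus \<open>\<epsilon>\<close> is also the sign of the summand of the action for the last position.\<close>

lemma sgn_n_eq: "sgn_n = (-1) ^ (n - 1)"
  using n_ge_2 by (auto simp: minus_one_power_iff sgn_n_def)

lemma multilinear_map_scale_last: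
  assumes "multilinear_map n sW sU g" "length xs = n - 1"
  shows "g (xs @ [sW c z]) = sU c (g (xs @ [z]))"
  using multilinear_map_scale[OF assms(1), of "xs @ [z]" "n - 1" c z] assms(2) n_ge_2
  by (simp add: list_update_append)

lemma action_snoc:
  assumes "length ps = n - 1"
  shows "action (ps @ [(w, z)]) = action (ps @ [(0, z)]) + sV sgn_n (mu (map snd ps) w)"
  using multilinear_map_add[OF action_multilinear, of "ps @ [(0, z)]" "n - 1" "(0, z)" "(w, 0)"]
    action_update_vector[of "ps @ [(0, z)]" "n - 1" w] assms n_ge_2
  by (simp add: list_update_append sgn_n_eq omit_nth_snoc_last)

text \<open>
  The second axiom of a representation, with the bracket in the last slot as the fundamental
  identity needs it. Moving it there past \<open>n - 2\<close> entries turns the signs \<open>(-1)\<^sup>k\<^sup>+\<^sup>1\<close> of that axiom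
  into \<open>\<epsilon> (-1)\<^sup>k\<close>.
\<close>

lemma mu_snoc_bracket:
  assumes xs: "length xs = n - 2" and ys: "length ys = n"
  shows "sV sgn_n (mu (xs @ [br ys]) v)
    = (\<Sum>k<n. sV ((-1) ^ k) (mu (omit_nth k ys) (mu (xs @ [ys ! k]) v)))"
proof -
  have "mu (br ys # xs) v = sV ((-1) ^ (n - 2)) (mu (xs @ [br ys]) v)"
    using alternating_map_move[OF mu_alternating V.vector_space_axioms, of "[]" "br ys" xs "[]"]
      xs n_ge_2 by simp
  also have "(-1) ^ (n - 2) = (- sgn_n)"
    using n_ge_2 by (auto simp: minus_one_power_iff sgn_n_def)
  finally have "sV sgn_n (mu (xs @ [br ys]) v) = - mu (br ys # xs) v"
    by simp
  then show ?thesis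
    using mu_bracket[OF ys xs, of v] by (simp add: sum_negf)
qed

text \<open>
  The previous lemma summed over the vectors in \<open>ps\<close>. The last argument has vector part 0, so the
  summand of the action that omits it vanishes, and the others contain it as an entry of \<open>\<mu>\<close>.
\<close>

lemma action_snoc_bracket:
  assumes ps: "length ps = n - 1" and ys: "length ys = n"
  shows "sV sgn_n (action (ps @ [(0, br ys)]))
    = (\<Sum>k<n. sV ((-1) ^ k) (mu (omit_nth k ys) (action (ps @ [(0, ys ! k)]))))"
proof -
  let ?m = "\<lambda>i z. mu (omit_nth i (map snd ps) @ [z]) (fst (ps ! i))"
  have act: "action (ps @ [(0, z)]) = (\<Sum>i<n - 1. sV ((-1) ^ i) (?m i z))" for z
  proof -
    have *: "(\<Sum>k<n. g k) = (\<Sum>k<n - 1. g k) + g (n - 1)" for g :: "nat \<Rightarrow> 'v"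
      using n_ge_2 by (cases n) auto
    show ?thesis
      unfolding action_def * using ps
      by (simp add: omit_nth_snoc omit_nth_snoc_last mu_zero nth_append)
  qed
  have "sV sgn_n (action (ps @ [(0, br ys)]))
      = (\<Sum>i<n - 1. sV ((-1) ^ i) (sV sgn_n (?m i (br ys))))"
    unfolding act V.scale_sum_right by (simp only: V.scale_left_commute)
  also have "\<dots> = (\<Sum>i<n - 1. sV ((-1) ^ i)
      (\<Sum>k<n. sV ((-1) ^ k) (mu (omit_nth k ys) (?m i (ys ! k)))))"
    using ps ys by (intro sum.cong refl arg_cong[of _ _ "sV _"] mu_snoc_bracket) (auto simp: length_omit_nth)
  also have "\<dots> = (\<Sum>k<n. \<Sum>i<n - 1. sV ((-1) ^ i)
      (sV ((-1) ^ k) (mu (omit_nth k ys) (?m i (ys ! k)))))"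
    unfolding V.scale_sum_right by (rule sum.swap)
  also have "\<dots> = (\<Sum>k<n. sV ((-1) ^ k) (mu (omit_nth k ys) (action (ps @ [(0, ys ! k)]))))"
    using ys by (intro sum.cong refl)
      (simp add: act mu_sum mu_scale length_omit_nth V.scale_sum_right mult.commute)
  finally show ?thesis .
qed

abbreviation "S \<equiv> semidirect_bracket n sL br sV mu f"

lemma semidirect_bracket_eq:
  assumes "length ps = n"
  shows "S ps = (action ps + sV sgn_n (f (map snd ps)), sL sgn_n (br (map snd ps)))"
  using assms by (simp add: semidirect_bracket_def action_def Let_def sgn_n_def)

lemma semidirect_bracket_alternating: "alternating_map n scale_VL scale_VL S"
proof -
  have f: "alternating_map n scale_VL sV (\<lambda>ps. f (map snd ps))"
    and b: "alternating_map n scale_VL sL (\<lambda>ps. br (map snd ps))"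
    using alternating_map_comp_map[OF _ linear_snd] f_alternating bracket_alternating by auto
  note ml = action_multilinear alternating_map_multilinear[OF f] alternating_map_multilinear[OF b]
  show ?thesis
    unfolding alternating_map_def multilinear_map_def
  proof (intro conjI allI impI, goal_cases)
    case (1 ps k)
    then show ?case
      using ml[THEN multilinear_map_add, of ps k] ml[THEN multilinear_map_scale, of ps k]
      unfolding Vector_Spaces.linear_iff
      by (auto simp: vector_space_VL semidirect_bracket_eq scale_VL V.scale_right_distrib scale_right_distrib
          mult.commute)
  next
    case (2 ps)
    then show ?case
      using action_alternating f b by (simp add: semidirect_bracket_eq alternating_map_def zero_prod_def)
  qed
qed

text \<open>
  The argument \<open>z\<close> of \<open>\<delta>f\<close> plays the same part as the entries of \<open>ys\<close>: the isolated terms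
  \<open>f(ys, [xs, z])\<close> and \<open>\<mu>(ys)(f(xs, z))\<close> are the summands for the last position of \<open>ys @ [z]\<close>.
\<close>

lemma coboundary_snoc:
  assumes xs: "length xs = n - 1" and ys: "length ys = n - 1"
  shows "coboundary n br sV mu f xs ys z =
    (let ws = ys @ [z] in
      f (xs @ [br ws]) + mu xs (f ws) - (\<Sum>k<n. f (ws[k := br (xs @ [ws ! k])]))
      - (\<Sum>k<n. sV ((-1) ^ k) (mu (omit_nth k ws) (sV sgn_n (f (xs @ [ws ! k]))))))"
proof -
  have *: "(\<Sum>k<n. g k) = (\<Sum>k<n - 1. g k) + g (n - 1)" for g :: "nat \<Rightarrow> 'v"
    using n_ge_2 by (cases n) auto
  let ?ws = "ys @ [z]"
  have "(\<Sum>k<n. f (?ws[k := br (xs @ [?ws ! k])]))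
      = (\<Sum>k<n - 1. f (ys[k := br (xs @ [ys ! k])] @ [z])) + f (ys @ [br (xs @ [z])])"
    unfolding * using ys
    by (intro arg_cong2[where f = "(+)"] sum.cong) (auto simp: nth_append list_update_append)
  moreover have "(\<Sum>k<n. sV ((-1) ^ k) (mu (omit_nth k ?ws) (sV sgn_n (f (xs @ [?ws ! k])))))
      = - (\<Sum>i<n - 1. sV ((-1) ^ (n + 1 + Suc i)) (mu (omit_nth i ys @ [z]) (f (xs @ [ys ! i]))))
        + mu ys (f (xs @ [z]))"
    unfolding * sum_negf[symmetric]
  proof (intro arg_cong2[where f = "(+)"] sum.cong refl)
    fix i assume i: "i \<in> {..<n - 1}"
    then have "length (omit_nth i ys @ [z]) = n - 1"
      using ys by (auto simp: length_omit_nth)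
    from mu_scale[OF this, of sgn_n] i show "sV ((-1) ^ i) (mu (omit_nth i ?ws) (sV sgn_n (f (xs @ [?ws ! i]))))
        = - sV ((-1) ^ (n + 1 + Suc i)) (mu (omit_nth i ys @ [z]) (f (xs @ [ys ! i])))"
      using ys by (simp add: omit_nth_snoc nth_append) (simp add: power_add sgn_n_def mult.commute)
  next
    have "(-1) ^ (n - 1) * sgn_n = 1"
      using sgn_n_square unfolding sgn_n_eq .
    then show "sV ((-1) ^ (n - 1)) (mu (omit_nth (n - 1) ?ws) (sV sgn_n (f (xs @ [?ws ! (n - 1)]))))
        = mu ys (f (xs @ [z]))"
      using ys by (simp add: omit_nth_snoc_last nth_append mu_scale)
  qed
  ultimately show ?thesis
    by (simp add: coboundary_def Let_def)
qed

text \<open>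
  Both sides of the fundamental identity are expanded by multilinearity. The terms in the action
  alone cancel by \<open>mu_derivation_action\<close> and \<open>action_snoc_bracket\<close>, those with values in \<open>L\<close> by
  the fundamental identity of \<open>L\<close>; \<open>coboundary_snoc\<close> identifies the rest.
\<close>

theorem fundamental_identity_defect:
  assumes ps: "length ps = n - 1" and qs: "length qs = n - 1"
  shows "S (ps @ [S (qs @ [q])]) - (\<Sum>k<n. S ((qs @ [q])[k := S (ps @ [(qs @ [q]) ! k])]))
    = (coboundary n br sV mu f (map snd ps) (map snd qs) (snd q), 0)"
proof -
  define rs where "rs = qs @ [q]"
  define xs where "xs = map snd ps"
  define ys where "ys = map snd rs"
  have len: "length rs = n" "length xs = n - 1" "length ys = n"
    using ps qs n_ge_2 by (auto simp: rs_def xs_def ys_def)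
  note f_ml = alternating_map_multilinear[OF f_alternating]
  note br_ml = alternating_map_multilinear[OF bracket_alternating]
  define b where "b k = br (xs @ [ys ! k])" for k
  define c where "c k = sV sgn_n (f (xs @ [ys ! k]))" for k
  define d where "d k = action (ps @ [(0, ys ! k)])" for k
  define e where "e k = action (rs[k := (mu xs (fst (rs ! k)), b k)])" for k
  \<comment> \<open>Since \<open>\<epsilon>\<^sup>2 = 1\<close>, the sign survives only in the two terms formed from the action.\<close>
  have lhs: "S (ps @ [S rs])
    = (sV sgn_n (action (ps @ [(0, br ys)])) + sV sgn_n (mu xs (action rs)) + mu xs (f ys)
        + f (xs @ [br ys]), br (xs @ [br ys]))"
  proof -
    have "action (ps @ [(0, sL sgn_n z)]) = sV sgn_n (action (ps @ [(0, z)]))" for z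
      using multilinear_map_scale_last[OF action_multilinear ps, of sgn_n "(0, z)"]
      by (simp add: scale_VL)
    then show ?thesis
      using ps len n_ge_2
      by (simp add: semidirect_bracket_eq action_snoc[of ps "_ + _"] multilinear_map_scale_last[OF f_ml]
          multilinear_map_scale_last[OF br_ml] mu_add mu_scale V.scale_right_distrib
          sgn_n_square flip: xs_def ys_def)
  qed
  have rhs: "S (rs[k := S (ps @ [rs ! k])])
      = (sV sgn_n (e k) + sV ((-1) ^ k) (mu (omit_nth k ys) (d k))
          + sV ((-1) ^ k) (mu (omit_nth k ys) (c k)) + f (ys[k := b k]), br (ys[k := b k]))"
    if k: "k < n" for k
  proof -
    \<comment> \<open>Up to an element of \<open>V\<close>, the inner bracket is \<open>\<epsilon>\<close> times the derivation applied to \<open>rs ! k\<close>.\<close>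
    have "S (ps @ [rs ! k]) = (action (ps @ [(fst (rs ! k), snd (rs ! k))]) + c k, sL sgn_n (b k))"
      using ps len k n_ge_2 by (simp add: semidirect_bracket_eq b_def c_def xs_def ys_def)
    also have "\<dots> = scale_VL sgn_n (mu xs (fst (rs ! k)), b k) + (d k + c k, 0)"
      unfolding action_snoc[OF ps, of "fst (rs ! k)"] using k len
      by (simp add: scale_VL d_def xs_def ys_def)
    finally have S1: "S (ps @ [rs ! k])
      = scale_VL sgn_n (mu xs (fst (rs ! k)), b k) + (d k + c k, 0)" .
    have "action (rs[k := S (ps @ [rs ! k])])
        = sV sgn_n (e k) + sV ((-1) ^ k) (mu (omit_nth k ys) (d k + c k))"
      unfolding S1 using k len
      by (simp add: multilinear_map_add[OF action_multilinear] e_def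
          multilinear_map_scale[OF action_multilinear] action_update_vector ys_def)
    moreover have "map snd (rs[k := S (ps @ [rs ! k])]) = ys[k := sL sgn_n (b k)]"
      unfolding S1 by (simp add: map_update ys_def scale_VL)
    ultimately show ?thesis
      using k len by (simp add: semidirect_bracket_eq multilinear_map_scale[OF f_ml] multilinear_map_scale[OF br_ml]
          mu_add length_omit_nth V.scale_right_distrib sgn_n_square)
  qed
  have "S (ps @ [S rs]) - (\<Sum>k<n. S (rs[k := S (ps @ [rs ! k])]))
     = (mu xs (f ys) + f (xs @ [br ys]) - (\<Sum>k<n. sV ((-1) ^ k) (mu (omit_nth k ys) (c k)))
         - (\<Sum>k<n. f (ys[k := b k])), 0)"
  proof -
    have "br (xs @ [br ys]) = (\<Sum>k<n. br (ys[k := b k]))"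
      using fundamental_identity[of xs ys] len by (simp add: b_def)
    moreover have "sV sgn_n (action (ps @ [(0, br ys)]))
        = (\<Sum>k<n. sV ((-1) ^ k) (mu (omit_nth k ys) (d k)))"
      using action_snoc_bracket[OF ps, of ys] len by (simp add: d_def)
    moreover have "mu xs (action rs) = (\<Sum>k<n. e k)"
      using mu_derivation_action[of xs rs] len by (simp add: e_def b_def ys_def)
    moreover have "(\<Sum>k<n. S (rs[k := S (ps @ [rs ! k])]))
        = (sV sgn_n (\<Sum>k<n. e k) + (\<Sum>k<n. sV ((-1) ^ k) (mu (omit_nth k ys) (d k)))
          + (\<Sum>k<n. sV ((-1) ^ k) (mu (omit_nth k ys) (c k))) + (\<Sum>k<n. f (ys[k := b k])),
          \<Sum>k<n. br (ys[k := b k]))"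
      unfolding V.scale_sum_right sum.distrib[symmetric] sum_prod[symmetric]
      by (intro sum.cong refl) (simp only: rhs lessThan_iff)
    ultimately show ?thesis
      by (simp add: lhs)
  qed
  also have "\<dots> = (coboundary n br sV mu f xs (map snd qs) (snd q), 0)"
    using coboundary_snoc[of xs "map snd qs" "snd q"] len qs
    by (simp add: ys_def rs_def b_def c_def Let_def)
  finally show ?thesis
    by (simp only: rs_def xs_def)
qed

end

theorem proposition2p9:
  fixes n :: nat
    and sL :: "'k::field \<Rightarrow> 'l::ab_group_add \<Rightarrow> 'l"
    and br :: "'l list \<Rightarrow> 'l"
    and sV :: "'k \<Rightarrow> 'v::ab_group_add \<Rightarrow> 'v"
    and mu :: "'l list \<Rightarrow> 'v \<Rightarrow> 'v"
    and f :: "'l list \<Rightarrow> 'v"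
  assumes "n \<ge> 2"
    and "n_Lie_algebra n sL br"
    and "n_Lie_representation n sL br sV mu"
    and "f \<in> C2 n sL sV"
  shows "n_Lie_algebra n (module_prod.scale sV sL) (semidirect_bracket n sL br sV mu f)
     \<longleftrightarrow> f \<in> Z2 n sL br sV mu"
proof -
  interpret n_Lie_representation n sL br sV mu by fact
  interpret n_Lie_cochain n sL br sV mu f
    using assms by unfold_locales (auto simp: C2_def)
  let ?D = "coboundary n br sV mu f"
  have "n_Lie_algebra n scale_VL S \<longleftrightarrow>
      (\<forall>ps rs. length ps = n - 1 \<longrightarrow> length rs = n \<longrightarrow>
        S (ps @ [S rs]) = (\<Sum>k<n. S (rs[k := S (ps @ [rs ! k])])))"
    unfolding n_Lie_algebra_def n_Lie_algebra_axioms_def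
    by (simp add: vector_space_VL semidirect_bracket_alternating)
  also have "\<dots> \<longleftrightarrow> (\<forall>ps qs q. length ps = n - 1 \<longrightarrow> length qs = n - 1 \<longrightarrow>
      S (ps @ [S (qs @ [q])]) = (\<Sum>k<n. S ((qs @ [q])[k := S (ps @ [(qs @ [q]) ! k])])))"
    (is "?l \<longleftrightarrow> ?r")
  proof
    assume ?l
    then show ?r using n_ge_2 by simp
  next
    assume r: ?r
    show ?l
    proof (intro allI impI)
      fix ps rs :: "('v \<times> 'l) list"
      assume "length ps = n - 1" and "length rs = n"
      moreover from this obtain qs q where "rs = qs @ [q]"
        using n_ge_2 by (cases rs rule: rev_cases) auto
      ultimately show "S (ps @ [S rs]) = (\<Sum>k<n. S (rs[k := S (ps @ [rs ! k])]))"
        using r[rule_format, of ps qs q] by auto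
    qed
  qed
  also have "\<dots> \<longleftrightarrow> (\<forall>ps qs q. length (ps :: ('v \<times> 'l) list) = n - 1 \<longrightarrow>
      length (qs :: ('v \<times> 'l) list) = n - 1 \<longrightarrow> ?D (map snd ps) (map snd qs) (snd (q :: 'v \<times> 'l)) = 0)"
  proof -
    have "S (ps @ [S (qs @ [q])]) = (\<Sum>k<n. S ((qs @ [q])[k := S (ps @ [(qs @ [q]) ! k])]))
        \<longleftrightarrow> ?D (map snd ps) (map snd qs) (snd q) = 0"
      if "length ps = n - 1" "length qs = n - 1" for ps qs q
      unfolding right_minus_eq[symmetric, of "S _"] fundamental_identity_defect[OF that]
      by (simp add: zero_prod_def)
    then show ?thesis by simp
  qed
  also have "\<dots> \<longleftrightarrow> (\<forall>xs ys z. length xs = n - 1 \<and> length ys = n - 1 \<longrightarrow> ?D xs ys z = 0)"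
    (is "?l \<longleftrightarrow> ?r")
  proof
    assume l: ?l
    show ?r
    proof (intro allI impI, elim conjE)
      \<comment> \<open>Lift the arguments to \<open>V \<oplus> L\<close> with vector part 0.\<close>
      fix xs ys :: "'l list" and z
      assume "length xs = n - 1" "length ys = n - 1"
      then show "?D xs ys z = 0"
        using l[rule_format, of "map (Pair 0) xs" "map (Pair 0) ys" "(0, z)"] by (simp add: comp_def)
    qed
  qed auto
  also have "\<dots> \<longleftrightarrow> f \<in> Z2 n sL br sV mu"
    using assms(4) by (simp add: Z2_def)
  finally show ?thesis .
qed

end
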